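(* In the group $\mathsf{G}_{Dend}$ of formal series in planar binary trees, the inverse of the series $\mathsf{Y}-(\mathsf{Y}/\mathsf{Y})$ is the series $\mathsf{Y}+(\mathsf{Y}/\mathsf{Y})\circ_1\boldsymbol{\Phi}$, where $$\boldsymbol{\Phi}=\sum_{n\geq 1}\ \sum_{[S,T]\in\mathcal{I}_n} T .$$
   Context: Planar binary trees have internal vertices of valence $3$, a root at the bottom and leaves at the top. $Y_n$ is the set of planar binary trees with $n\ge1$ internal vertices; $\mathsf{Y}$ is the unique element of $Y_1$; $|$ is the trivial tree with one leaf and no internal vertex. $S\vee T$ is the tree whose bottom internal vertex has left subtree $S$ and right subtree $T$ ($S,T$ possibly trivial). $S/T$ is obtained by identifying the root of $S$ with the leftmost leaf of $T$; $S\backslash T$ by identifying the root of $T$ with the rightmost leaf of $S$. In particular $\mathsf{Y}/\mathsf{Y}=\mathsf{Y}\vee|$ and $\mathsf{Y}\backslash\mathsf{Y}=|\vee\mathsf{Y}$. Tamari order on $Y_n$: $S\leq T$ iff one can pass from $S$ to $T$ by a (possibly empty) sequence of replacements of a subtree $A\vee(B\vee C)$ by $(A\vee B)\vee C$ ($A,B,C$ possibly trivial). $\mathcal{I}_n$ is the set of intervals $[S,T]$ ($S\le T$) of $Y_n$. Vector spaces are over a fixed field $K$. The associative product $*$ is defined on trees by $S*T=\sum_{S\backslash T\leq U\leq S/T}U$ (with unit $|$), extended bilinearly. On the span of nontrivial trees, the dendriform products are, for $S=S_1\vee S_2$ and $T=T_1\vee T_2$, $S\prec T=S_1\vee(S_2*T)$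 and $S\succ T=(S*T_1)\vee T_2$ (with $\vee$ extended bilinearly), so that $*=\prec+\succ$ and $(x\succ y)\prec z=x\succ(y\prec z)$; this is the free dendriform algebra on $\mathsf{Y}$. All operations extend to the completed space $\prod_{n\ge1}K Y_n$ of formal series of trees. The dendriform operad $Dend$ (non-symmetric) has $Dend(n)=KY_n$ and unit $\mathsf{Y}$. A tree $T=L\vee R\in Y_n$, where $L$ has $\ell$ internal vertices, acts as the $n$-ary operation $T(a_1,\dots,a_n)=L(a_1,\dots,a_\ell)\succ a_{\ell+1}\prec R(a_{\ell+2},\dots,a_n)$, where the factor involving $L$ (resp. $R$) is omitted if $L=|$ (resp. $R=|$). One has $T(\mathsf{Y},\dots,\mathsf{Y})=T$, and the partial composition is $S\circ_i T=S(\mathsf{Y},\dots,\mathsf{Y},T,\mathsf{Y},\dots,\mathsf{Y})$ with $T$ in position $i$, extended linearly to series. The group $\mathsf{G}_{Dend}$ is the set of formal series $F=\sum_{n\ge 1}\sum_{T\in Y_n}f_T\,T$ with $f_{\mathsf{Y}}=1$, with product $FG=\sum_{n\ge1}\sum_{T\in Y_n}f_T\,T(G,\dots,G)$ (linear in the left factor $F$) and unit $\mathsf{Y}$. *)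

theory Defs
  imports Main "HOL-Algebra.Group" "HOL-Library.Function_Algebras"
begin

section \<open>Planar binary trees\<close>

text \<open>The size function generated by the datatype package counts the internal vertices.\<close>

datatype pbt = Triv | Graft pbt pbt

abbreviation Y :: pbt where
  "Y \<equiv> Graft Triv Triv"

definition trees :: "nat \<Rightarrow> pbt set" where
  "trees n = {T. size T = n}"

primrec over :: "pbt \<Rightarrow> pbt \<Rightarrow> pbt" where
  "over S Triv = S"
| "over S (Graft L R) = Graft (over S L) R"

primrec under :: "pbt \<Rightarrow> pbt \<Rightarrow> pbt" where
  "under Triv T = T"
| "under (Graft L R) T = Graft L (under R T)"

lemma finite_trees: "finite (trees n)"
proof (induction n rule: less_induct)
  case (less n)
  have "trees n \<subseteq> insert Triv ((\<lambda>(L, R). Graft L R) ` ((\<Union>m<n. trees m) \<times> (\<Union>m<n. trees m)))"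
  proof
    fix T assume T: "T \<in> trees n"
    show "T \<in> insert Triv ((\<lambda>(L, R). Graft L R) ` ((\<Union>m<n. trees m) \<times> (\<Union>m<n. trees m)))"
    proof (cases T)
      case (Graft L R)
      then have "(L, R) \<in> (\<Union>m<n. trees m) \<times> (\<Union>m<n. trees m)"
        using T by (auto simp: trees_def)
      then show ?thesis
        using Graft by force
    qed simp
  qed
  moreover have "finite (\<Union>m<n. trees m)"
    using less by auto
  ultimately show ?case
    by (meson finite_SigmaI finite_imageI finite_insert finite_subset)
qed


section \<open>The Tamari order\<close>

inductive tamari_step :: "pbt \<Rightarrow> pbt \<Rightarrow> bool" where
  rotate: "tamari_step (Graft A (Graft B C)) (Graft (Graft A B) C)"
| left: "tamari_step L L' \<Longrightarrow> tamari_step (Graft L R) (Graft L' R)"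
| right: "tamari_step R R' \<Longrightarrow> tamari_step (Graft L R) (Graft L R')"

definition tamari_le :: "pbt \<Rightarrow> pbt \<Rightarrow> bool" (infix "\<preceq>" 50) where
  "S \<preceq> T \<longleftrightarrow> tamari_step\<^sup>*\<^sup>* S T"

text \<open>An interval is encoded by the pair of its end points.\<close>

definition tamari_intervals :: "nat \<Rightarrow> (pbt \<times> pbt) set" where
  "tamari_intervals n = {(S, T). S \<in> trees n \<and> T \<in> trees n \<and> S \<preceq> T}"


section \<open>Formal series of trees and the dendriform products\<close>

text \<open>
  A formal series is its coefficient function. Series in the completed space spanned by the
  nontrivial trees are those whose coefficient at the trivial tree vanishes.
\<close>

type_synonym 'k series = "pbt \<Rightarrow> 'k"

definition single :: "pbt \<Rightarrow> 'k::field series" where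
  "single T = (\<lambda>U. of_bool (U = T))"

text \<open>The bilinear extension of \<open>\<or>\<close> to series.\<close>

primrec graft_series :: "'k::field series \<Rightarrow> 'k series \<Rightarrow> 'k series" where
  "graft_series f g Triv = 0"
| "graft_series f g (Graft A B) = f A * g B"

definition star_tree :: "pbt \<Rightarrow> pbt \<Rightarrow> 'k::field series" where
  "star_tree S T = (\<lambda>U. of_bool (under S T \<preceq> U \<and> U \<preceq> over S T))"

text \<open>
  The dendriform products are only meant for nontrivial trees; the value 0 in the remaining cases
  is a dummy.
\<close>

fun prec_tree :: "pbt \<Rightarrow> pbt \<Rightarrow> 'k::field series" where
  "prec_tree (Graft S1 S2) (Graft T1 T2) =
     graft_series (single S1) (star_tree S2 (Graft T1 T2))"
| "prec_tree _ _ = 0"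

fun succ_tree :: "pbt \<Rightarrow> pbt \<Rightarrow> 'k::field series" where
  "succ_tree (Graft S1 S2) (Graft T1 T2) =
     graft_series (star_tree (Graft S1 S2) T1) (single T2)"
| "succ_tree _ _ = 0"

text \<open>
  Both products add up the numbers of internal vertices, so only finitely many pairs of trees
  contribute to a given coefficient of a product of two series.
\<close>

definition bilinear_ext ::
  "(pbt \<Rightarrow> pbt \<Rightarrow> 'k::field series) \<Rightarrow> 'k series \<Rightarrow> 'k series \<Rightarrow> 'k series" where
  "bilinear_ext p f g =
     (\<lambda>U. \<Sum>(S, T) | size S + size T = size U. f S * g T * p S T U)"

definition dprec :: "'k::field series \<Rightarrow> 'k series \<Rightarrow> 'k series" where
  "dprec = bilinear_ext prec_tree"

definition dsucc :: "'k::field series \<Rightarrow> 'k series \<Rightarrow> 'k series" where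
  "dsucc = bilinear_ext succ_tree"

lemma finite_tree_pairs: "finite {(S :: pbt, T :: pbt). size S + size T = n}"
proof (rule finite_subset)
  show "{(S :: pbt, T :: pbt). size S + size T = n} \<subseteq> (\<Union>m\<le>n. trees m) \<times> (\<Union>m\<le>n. trees m)"
    by (auto simp: trees_def)
qed (auto simp: finite_trees)


section \<open>The dendriform operad and its group of series\<close>

text \<open>
  \<open>act T a\<close> is \<open>T(a 1, \<dots>, a n)\<close> for \<open>n = size T \<ge> 1\<close>; the other values of \<open>a\<close> are not used.
  The value at the trivial tree is a dummy.
\<close>

primrec act :: "pbt \<Rightarrow> (nat \<Rightarrow> 'k::field series) \<Rightarrow> 'k series" where
  "act Triv a = 0"
| "act (Graft L R) a =
     (let l = size L;
          x = (if L = Triv then a (l + 1) else dsucc (act L a) (a (l + 1)))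
      in if R = Triv then x else dprec x (act R (\<lambda>i. a (l + 1 + i))))"

definition partial_comp :: "pbt \<Rightarrow> nat \<Rightarrow> 'k::field series \<Rightarrow> 'k series" where
  "partial_comp S i G = act S ((\<lambda>_. single Y)(i := G))"

text \<open>
  If \<open>G\<close> has no term at the trivial tree, \<open>T(G, \<dots>, G)\<close> only involves trees with at least
  \<open>size T\<close> internal vertices (see \<open>act_eq_0\<close> below), whence the bound on the sum.
\<close>

definition series_comp :: "'k::field series \<Rightarrow> 'k series \<Rightarrow> 'k series" where
  "series_comp F G =
     (\<lambda>U. \<Sum>T | 1 \<le> size T \<and> size T \<le> size U. F T * act T (\<lambda>_. G) U)"

definition G_Dend :: "'k::field series monoid" where
  "G_Dend = \<lparr>carrier = {F. F Triv = 0 \<and> F Y = 1}, mult = series_comp, one = single Y\<rparr>"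

lemma bilinear_ext_eq_0:
  assumes f: "\<And>S. size S < m \<Longrightarrow> f S = 0" and g: "\<And>T. size T < n \<Longrightarrow> g T = 0"
    and U: "size U < m + n"
  shows "bilinear_ext p f g U = 0"
proof -
  have "f S * g T * p S T U = 0" if "size S + size T = size U" for S T
  proof -
    have "size S < m \<or> size T < n"
      using that U by linarith
    then show ?thesis
      using f g by auto
  qed
  then show ?thesis
    unfolding bilinear_ext_def by (auto intro!: sum.neutral)
qed

lemma act_eq_0:
  assumes "\<And>i. a i Triv = 0" and "size U < size T"
  shows "act T a U = 0"
  using assms
proof (induction T arbitrary: a U)
  case Triv
  then show ?case by simp
next
  case (Graft L R)
  define l where "l = size L"
  define x where "x = (if L = Triv then a (l + 1) else dsucc (act L a) (a (l + 1)))"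
  have a1: "a i S = 0" if "size S < 1" for i S
    using that Graft.prems(1) by (cases S) auto
  have x0: "x S = 0" if "size S < size L + 1" for S
  proof (cases "L = Triv")
    case True
    then show ?thesis using that a1 by (simp add: x_def)
  next
    case False
    have "dsucc (act L a) (a (l + 1)) S = 0"
      unfolding dsucc_def
      by (rule bilinear_ext_eq_0[OF _ _ that]) (use Graft.IH(1) Graft.prems(1) a1 in auto)
    then show ?thesis using False by (simp add: x_def)
  qed
  have r: "dprec x (act R (\<lambda>i. a (l + 1 + i))) U = 0"
    unfolding dprec_def
    by (rule bilinear_ext_eq_0[where m = "size L + 1" and n = "size R"])
       (use x0 Graft.IH(2) Graft.prems in auto)
  have "act (Graft L R) a = (if R = Triv then x else dprec x (act R (\<lambda>i. a (l + 1 + i))))"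
    by (simp add: x_def l_def Let_def)
  then show ?case
    using r x0 Graft.prems(2) by (auto split: if_splits)
qed


section \<open>The series of Tamari intervals\<close>

definition Phi :: "'k::field series" where
  "Phi = (\<lambda>U. if U = Triv then 0
              else \<Sum>(S, T) \<in> tamari_intervals (size U). single T U)"

end

theory Submission
  imports Defs
begin

text \<open>
  Number the internal vertices of a tree from left to right. A tree \<open>U\<close> can be cut between its
  first \<open>p\<close> vertices and the others, along the path from the root to the leaf between them; call the
  pieces \<open>before p U\<close> and \<open>after p U\<close>. Both operations are monotone for the Tamari order, and this
  turns the interval in the definition of the product into an equation: \<open>U\<close> lies between
  \<open>under S T\<close> and \<open>over S T\<close> if and only if cutting \<open>U\<close> at \<open>size S\<close> yields \<open>S\<close> and \<open>T\<close>
  (\<open>between_under_over_iff\<close>). Hence \<open>f * g\<close> has at \<open>U\<close> the coefficient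
  \<open>\<Sum>p. f (before p U) * g (after p U)\<close>, and the two dendriform products are the parts of this sum
  where the root of \<open>U\<close> is in the left piece (\<open>\<prec>\<close>) or in the right one (\<open>\<succ>\<close>). The dendriform
  axioms become statements about pairs of cuts.

  Write \<open>X = | + \<Phi>\<close>, whose coefficient at \<open>U\<close> is the number of \<open>S \<preceq> U\<close>. Sorting these \<open>S\<close> by the
  position of their root gives \<open>X = | + H * X\<close> with \<open>H = X \<succ> Y\<close> (\<open>lower_set_cut\<close>,
  \<open>lower_recursion\<close>). Here \<open>H = Y + \<Phi> \<succ> Y\<close> is the claimed inverse. Since
  \<open>H \<succ> H = H \<succ> (X \<succ> Y) = (H * X) \<succ> Y = (X - |) \<succ> Y = H - Y\<close>, it satisfies
  \<open>H - H \<succ> H = Y\<close>, which says that it is a right inverse of \<open>F = Y - Y/Y\<close>.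

  A series \<open>G\<close> without constant term is determined by \<open>G - G \<succ> G\<close>, by induction on the size of
  trees (\<open>quadratic_unique\<close>), so the right inverse of \<open>F\<close> is unique. It is also a left inverse:
  substitution of \<open>F\<close> is a morphism for \<open>\<succ>\<close> (\<open>unital_subst_usucc\<close>), so applying it to
  \<open>H - H \<succ> H = Y\<close> shows that \<open>K = HF\<close> satisfies \<open>K - K \<succ> K = F = Y - Y \<succ> Y\<close>, whence \<open>K = Y\<close>.
\<close>

section \<open>Cutting a tree\<close>

fun before :: "nat \<Rightarrow> pbt \<Rightarrow> pbt" where
  "before p Triv = Triv"
| "before p (Graft A B) =
     (if p \<le> size A then before p A else Graft A (before (p - size A - 1) B))"

fun after :: "nat \<Rightarrow> pbt \<Rightarrow> pbt" where
  "after p Triv = Triv"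
| "after p (Graft A B) =
     (if p \<le> size A then Graft (after p A) B else after (p - size A - 1) B)"

text \<open>
  The position of the root in the left-to-right numbering of the vertices from 1 on; a cut at \<open>p\<close>
  puts the root into the left piece if and only if \<open>rank U \<le> p\<close>.
\<close>

primrec rank :: "pbt \<Rightarrow> nat" where
  "rank Triv = 0"
| "rank (Graft A B) = size A + 1"

lemma rank_le_size: "rank U \<le> size U"
  by (cases U) auto

lemma size_0_iff [simp]: "size (U :: pbt) = 0 \<longleftrightarrow> U = Triv"
  by (cases U) auto

lemma size_before [simp]: "p \<le> size U \<Longrightarrow> size (before p U) = p"
  by (induction U arbitrary: p) auto

lemma size_after [simp]: "p \<le> size U \<Longrightarrow> size (after p U) = size U - p"
  by (induction U arbitrary: p) auto

lemma before_0 [simp]: "before 0 U = Triv"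
  by (induction U) auto

lemma after_0 [simp]: "after 0 U = U"
  by (induction U) auto

lemma before_size [simp]: "before (size U) U = U"
  by (induction U) auto

lemma after_size [simp]: "after (size U) U = Triv"
  by (induction U) auto

lemma before_before: "p \<le> q \<Longrightarrow> q \<le> size U \<Longrightarrow> before p (before q U) = before p U"
  by (induction U arbitrary: p q) (auto simp: le_diff_conv)

lemma after_after: "p \<le> q \<Longrightarrow> q \<le> size U \<Longrightarrow> after (q - p) (after p U) = after q U"
proof (induction U arbitrary: p q)
  case (Graft A B)
  then show ?case
    using Graft.IH(2)[of "p - size A - 1" "q - size A - 1"] by (auto simp: Suc_diff_Suc)
qed auto

lemma after_before:
  "p \<le> q \<Longrightarrow> q \<le> size U \<Longrightarrow> after p (before q U) = before (q - p) (after p U)"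
proof (induction U arbitrary: p q)
  case (Graft A B)
  then show ?case
    using Graft.IH(2)[of "p - size A - 1" "q - size A - 1"] by (auto simp: Suc_diff_Suc)
qed auto

lemma rank_before: "rank U \<le> q \<Longrightarrow> rank (before q U) = rank U"
  by (cases U) auto

lemma rank_after: "p < rank U \<Longrightarrow> rank (after p U) = rank U - p"
  by (cases U) auto

section \<open>Cuts and the Tamari order\<close>

lemma tamari_refl [simp, intro]: "S \<preceq> S"
  by (simp add: tamari_le_def)

lemma tamari_trans [trans]: "S \<preceq> T \<Longrightarrow> T \<preceq> U \<Longrightarrow> S \<preceq> U"
  unfolding tamari_le_def by (rule rtranclp_trans)

lemma tamari_stepI: "tamari_step S T \<Longrightarrow> S \<preceq> T"
  by (auto simp: tamari_le_def)

lemma tamari_induct [consumes 1, case_names refl step]: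
  assumes "S \<preceq> T" "P S" "\<And>U V. S \<preceq> U \<Longrightarrow> tamari_step U V \<Longrightarrow> P U \<Longrightarrow> P V"
  shows "P T"
  using assms(1) unfolding tamari_le_def
  by (induction rule: rtranclp_induct) (use assms in \<open>auto simp: tamari_le_def\<close>)

lemma Graft_mono: "A \<preceq> A' \<Longrightarrow> B \<preceq> B' \<Longrightarrow> Graft A B \<preceq> Graft A' B'"
proof -
  assume A: "A \<preceq> A'" and B: "B \<preceq> B'"
  have "Graft A B \<preceq> Graft A' B"
    using A by (induction rule: tamari_induct) (auto intro: tamari_trans tamari_stepI tamari_step.left)
  also have "Graft A' B \<preceq> Graft A' B'"
    using B by (induction rule: tamari_induct) (auto intro: tamari_trans tamari_stepI tamari_step.right)
  finally show ?thesis .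
qed

lemma size_tamari_step: "tamari_step S T \<Longrightarrow> size S = size T"
  by (induction rule: tamari_step.induct) auto

lemma size_tamari: "S \<preceq> T \<Longrightarrow> size S = size T"
  by (induction rule: tamari_induct) (auto dest: size_tamari_step)

text \<open>
  A rotation strictly increases this statistic, so the Tamari order is antisymmetric.
\<close>

primrec left_weight :: "pbt \<Rightarrow> nat" where
  "left_weight Triv = 0"
| "left_weight (Graft A B) = size A + left_weight A + left_weight B"

lemma left_weight_step: "tamari_step S T \<Longrightarrow> left_weight S < left_weight T"
  by (induction rule: tamari_step.induct) (auto dest: size_tamari_step)

lemma left_weight_tamari: "S \<preceq> T \<Longrightarrow> S = T \<or> left_weight S < left_weight T"
  by (induction rule: tamari_induct) (auto dest: left_weight_step)

lemma tamari_antisym: "S \<preceq> T \<Longrightarrow> T \<preceq> S \<Longrightarrow> S = T"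
  using left_weight_tamari[of S T] left_weight_tamari[of T S] by auto

text \<open>
  If the cut separates the two vertices of the rotated edge, both trees have the same two pieces.
  Otherwise the piece that contains both vertices is rotated, and the other one stays the same.
\<close>

lemma before_step: "tamari_step S T \<Longrightarrow> before p S \<preceq> before p T"
proof (induction arbitrary: p rule: tamari_step.induct)
  case (rotate A B C)
  show ?case
    by (auto intro!: tamari_stepI tamari_step.rotate simp: not_le)
next
  case (left L L' R)
  then show ?case
    using size_tamari_step[OF left.hyps] by (auto intro!: Graft_mono intro: tamari_stepI)
next
  case (right R R' L)
  then show ?case by (auto intro!: Graft_mono)
qed

lemma after_step: "tamari_step S T \<Longrightarrow> after p S \<preceq> after p T"
proof (induction arbitrary: p rule: tamari_step.induct)
  case (rotate A B C)
  show ?case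
    by (auto intro!: tamari_stepI tamari_step.rotate simp: not_le)
next
  case (left L L' R)
  then show ?case
    using size_tamari_step[OF left.hyps] by (auto intro!: Graft_mono intro: tamari_stepI)
next
  case (right R R' L)
  then show ?case by (auto intro!: Graft_mono intro: tamari_stepI)
qed

lemma before_mono: "S \<preceq> T \<Longrightarrow> before p S \<preceq> before p T"
  by (induction rule: tamari_induct) (auto intro: tamari_trans before_step)

lemma after_mono: "S \<preceq> T \<Longrightarrow> after p S \<preceq> after p T"
  by (induction rule: tamari_induct) (auto intro: tamari_trans after_step)

lemma size_under [simp]: "size (under S T) = size S + size T"
  by (induction S) auto

lemma size_over [simp]: "size (over S T) = size S + size T"
  by (induction T) auto

lemma cut_under: "before (size S) (under S T) = S" "after (size S) (under S T) = T"
  by (induction S) auto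

lemma cut_over: "before (size S) (over S T) = S" "after (size S) (over S T) = T"
  by (induction T) auto

lemma under_Graft_le: "under S (Graft A B) \<preceq> Graft (under S A) B"
proof (induction S)
  case (Graft S1 S2)
  have "under (Graft S1 S2) (Graft A B) \<preceq> Graft S1 (Graft (under S2 A) B)"
    using Graft by (auto intro: Graft_mono)
  also have "\<dots> \<preceq> Graft (under (Graft S1 S2) A) B"
    by (auto intro: tamari_stepI tamari_step.rotate)
  finally show ?case .
qed auto

lemma Graft_over_le: "Graft A (over B T) \<preceq> over (Graft A B) T"
proof (induction T)
  case (Graft T1 T2)
  have "Graft A (over B (Graft T1 T2)) \<preceq> Graft (Graft A (over B T1)) T2"
    by (auto intro: tamari_stepI tamari_step.rotate)
  also have "\<dots> \<preceq> over (Graft A B) (Graft T1 T2)"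
    using Graft by (auto intro: Graft_mono)
  finally show ?case .
qed auto

lemma under_cut_le: "under (before p U) (after p U) \<preceq> U"
proof (induction U arbitrary: p)
  case (Graft A B)
  then show ?case
    by (auto intro: Graft_mono tamari_trans[OF under_Graft_le])
qed auto

lemma le_over_cut: "U \<preceq> over (before p U) (after p U)"
proof (induction U arbitrary: p)
  case (Graft A B)
  then show ?case
    by (auto intro: Graft_mono tamari_trans[OF _ Graft_over_le])
qed auto

text \<open>
  From left to right: both ends of the interval have the pieces \<open>S\<close> and \<open>T\<close>, so by monotonicity and
  antisymmetry every tree in between has them too.
\<close>

lemma between_under_over_iff:
  "under S T \<preceq> U \<and> U \<preceq> over S T \<longleftrightarrow>
     size S \<le> size U \<and> before (size S) U = S \<and> after (size S) U = T"
  (is "?L \<longleftrightarrow> ?R")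
proof
  assume L: ?L
  then have "S \<preceq> before (size S) U" "before (size S) U \<preceq> S"
    "T \<preceq> after (size S) U" "after (size S) U \<preceq> T"
    by (metis before_mono after_mono cut_under cut_over)+
  moreover have "size S \<le> size U"
    using L size_tamari[of "under S T" U] by simp
  ultimately show ?R
    by (blast intro: tamari_antisym)
next
  assume ?R
  then show ?L
    by (metis under_cut_le le_over_cut)
qed

section \<open>The dendriform products as sums over cuts\<close>

text \<open>
  The cuts at 0 and at \<open>size U\<close> are included, so the products below are defined on all series, and
  the trivial tree becomes a unit of \<open>ustar\<close>. With this convention the recursion for the action of
  a tree and the dendriform axioms need no case distinction on trivial factors. On series that
  vanish at the trivial tree these are the original products (\<open>dsucc_eq\<close>, \<open>dprec_eq\<close>).
\<close>

definition usucc :: "'k::field series \<Rightarrow> 'k series \<Rightarrow> 'k series" where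
  "usucc f g U = (\<Sum>p\<in>{..<rank U}. f (before p U) * g (after p U))"

definition uprec :: "'k::field series \<Rightarrow> 'k series \<Rightarrow> 'k series" where
  "uprec f g U = (\<Sum>p\<in>{rank U..size U}. f (before p U) * g (after p U))"

definition ustar :: "'k::field series \<Rightarrow> 'k series \<Rightarrow> 'k series" where
  "ustar f g U = (\<Sum>p\<in>{..size U}. f (before p U) * g (after p U))"

lemma ustar_eq: "ustar f g = usucc f g + uprec f g"
proof
  fix U
  have "{..size U} = {..<rank U} \<union> {rank U..size U}"
    using rank_le_size[of U] by auto
  then have "ustar f g U = usucc f g U + uprec f g U"
    unfolding ustar_def usucc_def uprec_def by (simp add: sum.union_disjoint ivl_disj_int)
  then show "ustar f g U = (usucc f g + uprec f g) U" by simp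
qed

lemma usucc_Triv [simp]: "usucc f g Triv = 0"
  by (simp add: usucc_def)

lemma uprec_Triv [simp]: "uprec f g Triv = f Triv * g Triv"
  by (simp add: uprec_def)

text \<open>
  Both bracketings of a product of three factors are sums over pairs of cuts that split a tree into
  three consecutive pieces. Each dendriform axiom then reduces to the equality of two index sets,
  described by the position of the root relative to the two cuts.
\<close>

definition two_cuts ::
  "(nat \<times> nat) set \<Rightarrow> 'k::field series \<Rightarrow> 'k series \<Rightarrow> 'k series \<Rightarrow> 'k series" where
  "two_cuts D f g h U =
     (\<Sum>(p, q)\<in>D. f (before p U) * g (after p (before q U)) * h (after q U))"

lemma nested_left:
  fixes f g h :: "'k::field series"
  assumes Q: "Q \<subseteq> {..size U}" and P: "\<And>q. q \<in> Q \<Longrightarrow> P q \<subseteq> {..q}"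
  shows "(\<Sum>q\<in>Q. (\<Sum>p\<in>P q. f (before p (before q U)) * g (after p (before q U))) * h (after q U)) =
         two_cuts {(p, q). q \<in> Q \<and> p \<in> P q} f g h U"
proof -
  have fin: "finite Q" "\<And>q. q \<in> Q \<Longrightarrow> finite (P q)"
    using Q P by (auto intro: finite_subset)
  have "(\<Sum>q\<in>Q. (\<Sum>p\<in>P q. f (before p (before q U)) * g (after p (before q U))) * h (after q U)) =
        (\<Sum>q\<in>Q. \<Sum>p\<in>P q. f (before p U) * g (after p (before q U)) * h (after q U))"
    unfolding sum_distrib_right
    using Q P by (intro sum.cong refl) (auto simp: before_before subset_eq)
  also have "\<dots> = (\<Sum>(q, p)\<in>Sigma Q P. f (before p U) * g (after p (before q U)) * h (after q U))"
    using fin by (subst sum.Sigma) auto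
  also have "\<dots> = two_cuts {(p, q). q \<in> Q \<and> p \<in> P q} f g h U"
    unfolding two_cuts_def
    by (rule sum.reindex_bij_witness[of _ prod.swap prod.swap]) auto
  finally show ?thesis .
qed

lemma nested_right:
  fixes f g h :: "'k::field series"
  assumes P: "P \<subseteq> {..size U}" and K: "\<And>p. p \<in> P \<Longrightarrow> K p \<subseteq> {..size U - p}"
  shows "(\<Sum>p\<in>P. f (before p U) * (\<Sum>k\<in>K p. g (before k (after p U)) * h (after k (after p U)))) =
         two_cuts {(p, q). p \<in> P \<and> p \<le> q \<and> q - p \<in> K p} f g h U"
proof -
  have fin: "finite P" "\<And>p. p \<in> P \<Longrightarrow> finite (K p)"
    using P K by (auto intro: finite_subset)
  have "(\<Sum>p\<in>P. f (before p U) * (\<Sum>k\<in>K p. g (before k (after p U)) * h (after k (after p U)))) =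
        (\<Sum>p\<in>P. \<Sum>k\<in>K p. f (before p U) * g (before k (after p U)) * h (after k (after p U)))"
    unfolding sum_distrib_left by (simp add: mult.assoc)
  also have "\<dots> = (\<Sum>(p, k)\<in>Sigma P K. f (before p U) * g (before k (after p U)) * h (after k (after p U)))"
    using fin by (subst sum.Sigma) auto
  also have "\<dots> = two_cuts {(p, q). p \<in> P \<and> p \<le> q \<and> q - p \<in> K p} f g h U"
    unfolding two_cuts_def
  proof (rule sum.reindex_bij_witness[of _ "\<lambda>(p, q). (p, q - p)" "\<lambda>(p, k). (p, p + k)"], goal_cases)
    case (5 a)
    obtain p k where a: "a = (p, k)" "p \<in> P" "k \<in> K p" using 5 by auto
    then have "p \<le> size U" "k \<le> size U - p"
      using P K[of p] by (auto simp: subset_eq)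
    then have "p \<le> size U" "p + k \<le> size U"
      by auto
    then show ?case
      using after_before[of p "p + k" U] after_after[of p "p + k" U] a by simp
  qed auto
  finally show ?thesis .
qed

text \<open>
  On both sides the root is in the first of the three pieces.
\<close>

lemma prec_prec: "uprec (uprec f g) h = uprec f (ustar g h)"
proof
  fix U
  let ?r = "rank U" and ?n = "size U"
  have "uprec (uprec f g) h U = (\<Sum>q\<in>{?r..?n}. (\<Sum>p\<in>{?r..q}. f (before p (before q U)) * g (after p (before q U))) * h (after q U))"
    by (auto simp: uprec_def rank_before intro!: sum.cong)
  also have "\<dots> = two_cuts {(p, q). q \<in> {?r..?n} \<and> p \<in> {?r..q}} f g h U"
    by (rule nested_left) auto
  also have "{(p, q). q \<in> {?r..?n} \<and> p \<in> {?r..q}} = {(p, q). p \<in> {?r..?n} \<and> p \<le> q \<and> q - p \<in> {..?n - p}}"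
    by auto
  also have "two_cuts \<dots> f g h U = (\<Sum>p\<in>{?r..?n}. f (before p U) * (\<Sum>k\<in>{..?n - p}. g (before k (after p U)) * h (after k (after p U))))"
    by (rule nested_right[symmetric]) auto
  also have "\<dots> = uprec f (ustar g h) U"
    by (auto simp: uprec_def ustar_def intro!: sum.cong)
  finally show "uprec (uprec f g) h U = uprec f (ustar g h) U" .
qed

text \<open>
  On both sides the root is in the middle piece.
\<close>

lemma succ_prec: "uprec (usucc f g) h = usucc f (uprec g h)"
proof
  fix U
  let ?r = "rank U" and ?n = "size U"
  have "uprec (usucc f g) h U = (\<Sum>q\<in>{?r..?n}. (\<Sum>p\<in>{..<?r}. f (before p (before q U)) * g (after p (before q U))) * h (after q U))"
    by (auto simp: uprec_def usucc_def rank_before intro!: sum.cong)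
  also have "\<dots> = two_cuts {(p, q). q \<in> {?r..?n} \<and> p \<in> {..<?r}} f g h U"
    by (rule nested_left) auto
  also have "{(p, q). q \<in> {?r..?n} \<and> p \<in> {..<?r}} = {(p, q). p \<in> {..<?r} \<and> p \<le> q \<and> q - p \<in> {?r - p..?n - p}}"
    using rank_le_size[of U] by auto
  also have "two_cuts \<dots> f g h U = (\<Sum>p\<in>{..<?r}. f (before p U) * (\<Sum>k\<in>{?r - p..?n - p}. g (before k (after p U)) * h (after k (after p U))))"
    using rank_le_size[of U] by (intro nested_right[symmetric]) auto
  also have "\<dots> = usucc f (uprec g h) U"
    using rank_le_size[of U] by (auto simp: uprec_def usucc_def rank_after intro!: sum.cong)
  finally show "uprec (usucc f g) h U = usucc f (uprec g h) U" .
qed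

text \<open>
  On both sides the root is in the last piece.
\<close>

lemma star_succ: "usucc (ustar f g) h = usucc f (usucc g h)"
proof
  fix U
  let ?r = "rank U" and ?n = "size U"
  have "usucc (ustar f g) h U = (\<Sum>q\<in>{..<?r}. (\<Sum>p\<in>{..q}. f (before p (before q U)) * g (after p (before q U))) * h (after q U))"
    using rank_le_size[of U] by (auto simp: ustar_def usucc_def intro!: sum.cong)
  also have "\<dots> = two_cuts {(p, q). q \<in> {..<?r} \<and> p \<in> {..q}} f g h U"
    using rank_le_size[of U] by (intro nested_left) auto
  also have "{(p, q). q \<in> {..<?r} \<and> p \<in> {..q}} = {(p, q). p \<in> {..<?r} \<and> p \<le> q \<and> q - p \<in> {..<?r - p}}"
    by auto
  also have "two_cuts \<dots> f g h U = (\<Sum>p\<in>{..<?r}. f (before p U) * (\<Sum>k\<in>{..<?r - p}. g (before k (after p U)) * h (after k (after p U))))"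
    using rank_le_size[of U] by (intro nested_right[symmetric]) auto
  also have "\<dots> = usucc f (usucc g h) U"
    by (auto simp: usucc_def rank_after intro!: sum.cong)
  finally show "usucc (ustar f g) h U = usucc f (usucc g h) U" .
qed

section \<open>The cut formulas agree with the tree products\<close>

lemma star_tree_eq:
  "star_tree S T U = of_bool (size S \<le> size U \<and> before (size S) U = S \<and> after (size S) U = T)"
  by (simp only: star_tree_def between_under_over_iff)

lemma succ_tree_eq:
  "succ_tree S T U =
     of_bool (S \<noteq> Triv \<and> T \<noteq> Triv \<and> size S < rank U \<and> before (size S) U = S \<and> after (size S) U = T)"
proof (cases S; cases T; cases U)
  fix S1 S2 T1 T2 U1 U2
  assume "S = Graft S1 S2" "T = Graft T1 T2" "U = Graft U1 U2"
  then show ?thesis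
    by (auto simp: star_tree_eq single_def of_bool_def)
qed auto

lemma prec_tree_eq:
  "prec_tree S T U =
     of_bool (S \<noteq> Triv \<and> T \<noteq> Triv \<and> rank U \<le> size S \<and> size S \<le> size U
       \<and> before (size S) U = S \<and> after (size S) U = T)"
proof (cases S; cases T; cases U)
  fix S1 S2 T1 T2 U1 U2
  assume *: "S = Graft S1 S2" "T = Graft T1 T2" "U = Graft U1 U2"
  show ?thesis
    by (cases "S1 = U1") (use * in \<open>auto simp: star_tree_eq single_def of_bool_def\<close>)
qed auto

text \<open>
  If a product of trees is a sum of basis trees selected by a condition on the cut position, then only
  the pairs that arise by cutting \<open>U\<close> contribute to the coefficient at \<open>U\<close>.
\<close>

lemma bilinear_ext_cuts:
  fixes f g :: "'k::field series"
  assumes f: "f Triv = 0" and g: "g Triv = 0"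
    and t: "\<And>S T. t S T U = of_bool (S \<noteq> Triv \<and> T \<noteq> Triv \<and> size S \<in> P
      \<and> before (size S) U = S \<and> after (size S) U = T)"
    and P: "P \<subseteq> {..size U}"
  shows "bilinear_ext t f g U = (\<Sum>p\<in>P. f (before p U) * g (after p U))"
proof -
  let ?D = "{(S :: pbt, T :: pbt). size S + size T = size U}"
  let ?c = "\<lambda>p. (before p U, after p U)"
  have inj: "inj_on ?c P"
    by (rule inj_onI) (use P in \<open>metis (no_types, lifting) Pair_inject atMost_iff size_before subsetD\<close>)
  have sub: "?c ` P \<subseteq> ?D"
    using P by (auto simp: subset_eq)
  have "bilinear_ext t f g U = (\<Sum>(S, T)\<in>?D. f S * g T * t S T U)"
    by (simp add: bilinear_ext_def)
  also have "\<dots> = (\<Sum>(S, T)\<in>?c ` P. f S * g T * t S T U)"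
  proof (rule sum.mono_neutral_right[OF finite_tree_pairs sub])
    have "(S, T) \<in> ?c ` P" if "t S T U \<noteq> 0" for S T
      using that by (auto simp: t intro!: image_eqI[of _ _ "size S"])
    then show "\<forall>x\<in>?D - ?c ` P. (case x of (S, T) \<Rightarrow> f S * g T * t S T U) = 0"
      by fastforce
  qed
  also have "\<dots> = (\<Sum>p\<in>P. f (before p U) * g (after p U) * t (before p U) (after p U) U)"
    by (subst sum.reindex[OF inj]) simp
  also have "\<dots> = (\<Sum>p\<in>P. f (before p U) * g (after p U))"
  proof (rule sum.cong[OF refl])
    fix p assume "p \<in> P"
    then have "size (before p U) = p" using P by auto
    then show "f (before p U) * g (after p U) * t (before p U) (after p U) U = f (before p U) * g (after p U)"
      using \<open>p \<in> P\<close> f g by (cases "before p U = Triv"; cases "after p U = Triv") (auto simp: t)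
  qed
  finally show ?thesis .
qed

lemma dsucc_eq:
  assumes "f Triv = 0" "g Triv = 0"
  shows "dsucc f g = usucc f g"
proof
  fix U
  show "dsucc f g U = usucc f g U"
    unfolding dsucc_def usucc_def
    by (rule bilinear_ext_cuts) (use assms rank_le_size[of U] in \<open>auto simp: succ_tree_eq\<close>)
qed

lemma dprec_eq:
  assumes "f Triv = 0" "g Triv = 0"
  shows "dprec f g = uprec f g"
proof
  fix U
  show "dprec f g U = uprec f g U"
    unfolding dprec_def uprec_def
    by (rule bilinear_ext_cuts) (use assms in \<open>auto simp: prec_tree_eq conj_assoc\<close>)
qed

section \<open>Substitution preserves the products\<close>

lemma single_self [simp]: "single T T = 1"
  by (simp add: single_def)

lemma usucc_unit_left: "g Triv = 0 \<Longrightarrow> usucc (single Triv) g = g"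
proof
  fix U assume g: "g Triv = 0"
  show "usucc (single Triv) g U = g U"
  proof (cases "U = Triv")
    case False
    then have r: "0 < rank U" by (cases U) auto
    have "usucc (single Triv) g U = (\<Sum>p\<in>{0}. single Triv (before p U) * g (after p U))"
      unfolding usucc_def
    proof (rule sum.mono_neutral_right)
      show "\<forall>p\<in>{..<rank U} - {0}. single Triv (before p U) * g (after p U) = 0"
      proof
        fix p assume "p \<in> {..<rank U} - {0}"
        then have "size (before p U) \<noteq> 0" using rank_le_size[of U] by simp
        then show "single Triv (before p U) * g (after p U) = 0" by (auto simp: single_def)
      qed
    qed (use r in auto)
    then show ?thesis by simp
  qed (use g in simp)
qed

lemma usucc_unit_right: "usucc f (single Triv) = 0"
proof
  fix U
  have "f (before p U) * single Triv (after p U) = 0" if "p < rank U" for p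
  proof -
    have "size (after p U) \<noteq> 0" using that rank_le_size[of U] by simp
    then show ?thesis by (auto simp: single_def)
  qed
  then show "usucc f (single Triv) U = 0 U"
    unfolding usucc_def zero_fun_apply by (intro sum.neutral) blast
qed

lemma uprec_unit_right: "uprec f (single Triv) = f"
proof
  fix U
  have "uprec f (single Triv) U = (\<Sum>p\<in>{size U}. f (before p U) * single Triv (after p U))"
    unfolding uprec_def
  proof (rule sum.mono_neutral_right)
    show "\<forall>p\<in>{rank U..size U} - {size U}. f (before p U) * single Triv (after p U) = 0"
    proof
      fix p assume "p \<in> {rank U..size U} - {size U}"
      then have "size (after p U) \<noteq> 0" by auto
      then show "f (before p U) * single Triv (after p U) = 0" by (auto simp: single_def)
    qed
  qed (use rank_le_size[of U] in auto)
  then show "uprec f (single Triv) U = f U" by simp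
qed

lemma uprec_unit_left: "g Triv = 0 \<Longrightarrow> uprec (single Triv) g = 0"
proof
  fix U assume g: "g Triv = 0"
  have "single Triv (before p U) * g (after p U) = 0" if "rank U \<le> p" "p \<le> size U" for p
  proof (cases "U = Triv")
    case False
    then have "size (before p U) \<noteq> 0" using that by (cases U) auto
    then show ?thesis by (auto simp: single_def)
  qed (use g in simp)
  then show "uprec (single Triv) g U = 0 U"
    unfolding uprec_def zero_fun_apply by (intro sum.neutral) auto
qed

text \<open>
  Sending the trivial tree to the unit of \<open>ustar\<close>, instead of 0 as in \<open>act\<close>, gives the action of a
  graft the same form for trivial and nontrivial subtrees (\<open>unital_act_Graft\<close>).
\<close>

definition unital_act :: "'k::field series \<Rightarrow> pbt \<Rightarrow> 'k series" where
  "unital_act G T = (if T = Triv then single Triv else act T (\<lambda>_. G))"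

lemma unital_act_Triv [simp]: "unital_act G Triv = single Triv"
  by (simp add: unital_act_def)

lemma unital_act_eq_0: "G Triv = 0 \<Longrightarrow> size U < size T \<Longrightarrow> unital_act G T U = 0"
  by (auto simp: unital_act_def act_eq_0)

lemma unital_act_Graft:
  assumes G: "G Triv = 0"
  shows "unital_act G (Graft L R) = uprec (usucc (unital_act G L) G) (unital_act G R)"
proof -
  have act0: "act T (\<lambda>_. G) Triv = 0" if "T \<noteq> Triv" for T
    using that G by (intro act_eq_0) (auto simp: neq0_conv[symmetric] simp del: neq0_conv)
  have x: "(if L = Triv then G else dsucc (act L (\<lambda>_. G)) G) = usucc (unital_act G L) G"
    using G act0 by (simp add: unital_act_def usucc_unit_left dsucc_eq)
  show ?thesis
  proof (cases "R = Triv")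
    case True
    then show ?thesis using x by (simp add: unital_act_def Let_def uprec_unit_right)
  next
    case False
    then have "unital_act G (Graft L R) = dprec (usucc (unital_act G L) G) (act R (\<lambda>_. G))"
      using x by (simp add: unital_act_def Let_def)
    also have "\<dots> = uprec (usucc (unital_act G L) G) (unital_act G R)"
      using False act0 by (simp add: dprec_eq unital_act_def)
    finally show ?thesis .
  qed
qed

definition product_trees :: "pbt \<Rightarrow> pbt \<Rightarrow> pbt set" where
  "product_trees S T = {W. size W = size S + size T \<and> before (size S) W = S \<and> after (size S) W = T}"

lemma finite_product_trees [simp, intro]: "finite (product_trees S T)"
  by (rule finite_subset[OF _ finite_trees[of "size S + size T"]]) (auto simp: product_trees_def trees_def)

lemma product_trees_Graft_right:
  "{W \<in> product_trees S (Graft T1 T2). size S < rank W} = (\<lambda>W. Graft W T2) ` product_trees S T1"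
proof (intro equalityI subsetI)
  fix W assume W: "W \<in> {W \<in> product_trees S (Graft T1 T2). size S < rank W}"
  then obtain W1 W2 where eq: "W = Graft W1 W2"
    by (cases W) simp_all
  have le: "size S \<le> size W1" using W eq by simp
  have cut: "before (size S) W = S" "after (size S) W = Graft T1 T2"
    "size W = size S + size (Graft T1 T2)"
    using W by (simp_all add: product_trees_def)
  have "before (size S) W1 = S" using cut(1) le by (simp add: eq)
  moreover have "after (size S) W1 = T1" "W2 = T2" using cut(2) le by (simp_all add: eq)
  moreover have "size W1 = size S + size T1"
    using cut(3) \<open>W2 = T2\<close> by (simp add: eq)
  ultimately have "W2 = T2" "W1 \<in> product_trees S T1"
    by (simp_all add: product_trees_def)
  then show "W \<in> (\<lambda>W. Graft W T2) ` product_trees S T1"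
    by (simp add: eq)
next
  fix W assume "W \<in> (\<lambda>W. Graft W T2) ` product_trees S T1"
  then obtain W1 where "W = Graft W1 T2" "W1 \<in> product_trees S T1"
    by blast
  then show "W \<in> {W \<in> product_trees S (Graft T1 T2). size S < rank W}"
    by (simp add: product_trees_def)
qed

lemma product_trees_Graft_left:
  "{W \<in> product_trees (Graft S1 S2) T. rank W \<le> size (Graft S1 S2)} = Graft S1 ` product_trees S2 T"
proof (intro equalityI subsetI)
  fix W assume W: "W \<in> {W \<in> product_trees (Graft S1 S2) T. rank W \<le> size (Graft S1 S2)}"
  then obtain W1 W2 where eq: "W = Graft W1 W2"
    by (cases W) (simp_all add: product_trees_def)
  have not_le: "\<not> Suc (size S1 + size S2) \<le> size W1" using W eq by simp
  have cut: "before (size (Graft S1 S2)) W = Graft S1 S2" "after (size (Graft S1 S2)) W = T"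
    "size W = size (Graft S1 S2) + size T"
    using W by (simp_all add: product_trees_def)
  have W1: "W1 = S1" using cut(1) not_le by (simp add: eq)
  have "before (size S2) W2 = S2" using cut(1) by (simp add: eq W1)
  moreover have "after (size S2) W2 = T" using cut(2) by (simp add: eq W1)
  moreover have "size W2 = size S2 + size T" using cut(3) by (simp add: eq W1)
  ultimately have "W2 \<in> product_trees S2 T"
    by (simp add: product_trees_def)
  then show "W \<in> Graft S1 ` product_trees S2 T"
    by (simp add: eq W1)
next
  fix W assume "W \<in> Graft S1 ` product_trees S2 T"
  then obtain W2 where "W = Graft S1 W2" "W2 \<in> product_trees S2 T"
    by blast
  then show "W \<in> {W \<in> product_trees (Graft S1 S2) T. rank W \<le> size (Graft S1 S2)}"
    by (simp add: product_trees_def)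
qed

lemma usucc_sum_left: "usucc (\<lambda>V. \<Sum>W\<in>A. x W V) g U = (\<Sum>W\<in>A. usucc (x W) g U)"
  unfolding usucc_def sum_distrib_right by (rule sum.swap)

lemma uprec_sum_left: "uprec (\<lambda>V. \<Sum>W\<in>A. x W V) g U = (\<Sum>W\<in>A. uprec (x W) g U)"
  unfolding uprec_def sum_distrib_right by (rule sum.swap)

lemma uprec_sum_right: "uprec f (\<lambda>V. \<Sum>W\<in>A. x W V) U = (\<Sum>W\<in>A. uprec f (x W) U)"
  unfolding uprec_def sum_distrib_left by (rule sum.swap)

text \<open>
  This is where the freeness of the dendriform algebra on one generator enters: \<open>T \<mapsto> T(G, \<dots>, G)\<close> is a
  morphism for both products. Writing \<open>S\<close> or \<open>T\<close> as a graft and applying the matching axiom reduces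
  each product to \<open>ustar\<close> of smaller trees, which is the sum of both induction hypotheses.
\<close>

lemma unital_act_products:
  assumes G: "G Triv = 0"
  shows "usucc (unital_act G S) (unital_act G T) U = (\<Sum>W | W \<in> product_trees S T \<and> size S < rank W. unital_act G W U)"
    and "uprec (unital_act G S) (unital_act G T) U = (\<Sum>W | W \<in> product_trees S T \<and> rank W \<le> size S. unital_act G W U)"
proof (induction "size S + size T" arbitrary: S T U rule: less_induct)
  case less
  have star: "ustar (unital_act G A) (unital_act G B) = (\<lambda>U. \<Sum>W\<in>product_trees A B. unital_act G W U)"
    if "size A + size B < size S + size T" for A B
  proof
    fix U
    have "product_trees A B = {W \<in> product_trees A B. size A < rank W} \<union> {W \<in> product_trees A B. rank W \<le> size A}"
      by auto
    then have "(\<Sum>W\<in>product_trees A B. unital_act G W U) =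
        (\<Sum>W | W \<in> product_trees A B \<and> size A < rank W. unital_act G W U) +
        (\<Sum>W | W \<in> product_trees A B \<and> rank W \<le> size A. unital_act G W U)"
      by (subst sum.union_disjoint[symmetric]) (auto intro!: sum.cong)
    then show "ustar (unital_act G A) (unital_act G B) U = (\<Sum>W\<in>product_trees A B. unital_act G W U)"
      using less[OF that] by (simp add: ustar_eq)
  qed
  {
    case 1
    show ?case
    proof (cases T)
      case Triv
      have "rank W \<le> size S" if "W \<in> product_trees S Triv" for W
        using that rank_le_size[of W] by (simp add: product_trees_def)
      then have empty: "{W. W \<in> product_trees S Triv \<and> size S < rank W} = {}"
        by (auto dest: leD)
      show ?thesis
        by (simp only: Triv empty unital_act_Triv usucc_unit_right sum.empty zero_fun_apply)
    next
      case (Graft T1 T2)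
      have "usucc (unital_act G S) (unital_act G T) = uprec (usucc (ustar (unital_act G S) (unital_act G T1)) G) (unital_act G T2)"
        by (simp add: Graft unital_act_Graft[of G, OF G] succ_prec[symmetric] star_succ)
      also have "ustar (unital_act G S) (unital_act G T1) = (\<lambda>U. \<Sum>W\<in>product_trees S T1. unital_act G W U)"
        by (rule star) (simp add: Graft)
      finally have "usucc (unital_act G S) (unital_act G T) U =
          (\<Sum>W\<in>product_trees S T1. uprec (usucc (unital_act G W) G) (unital_act G T2) U)"
        by (simp add: usucc_sum_left[abs_def] uprec_sum_left)
      also have "\<dots> = (\<Sum>W\<in>(\<lambda>W. Graft W T2) ` product_trees S T1. unital_act G W U)"
        by (simp add: sum.reindex inj_on_def unital_act_Graft[of G, OF G])
      finally show ?thesis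
        by (simp add: Graft product_trees_Graft_right)
    qed
  next
    case 2
    show ?case
    proof (cases S)
      case Triv
      show ?thesis
      proof (cases "T = Triv")
        case True
        have "{W. W \<in> product_trees Triv Triv \<and> rank W \<le> 0} = {Triv}"
          by (auto simp: product_trees_def)
        then show ?thesis using Triv True by (simp add: uprec_unit_right)
      next
        case False
        then have empty: "{W. W \<in> product_trees Triv T \<and> rank W \<le> size Triv} = {}"
          by (cases T) (auto simp: product_trees_def)
        have T0: "unital_act G T Triv = 0"
          using False G by (cases T) (auto intro: unital_act_eq_0)
        show ?thesis
          by (simp only: Triv empty unital_act_Triv uprec_unit_left[of "unital_act G T", OF T0] sum.empty zero_fun_apply)
      qed
    next
      case (Graft S1 S2)
      have "uprec (unital_act G S) (unital_act G T) = uprec (usucc (unital_act G S1) G) (ustar (unital_act G S2) (unital_act G T))"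
        by (simp add: Graft unital_act_Graft[of G, OF G] prec_prec)
      also have "ustar (unital_act G S2) (unital_act G T) = (\<lambda>U. \<Sum>W\<in>product_trees S2 T. unital_act G W U)"
        by (rule star) (simp add: Graft)
      finally have "uprec (unital_act G S) (unital_act G T) U =
          (\<Sum>W\<in>product_trees S2 T. uprec (usucc (unital_act G S1) G) (unital_act G W) U)"
        by (simp add: uprec_sum_right)
      also have "\<dots> = (\<Sum>W\<in>Graft S1 ` product_trees S2 T. unital_act G W U)"
        by (simp add: sum.reindex inj_on_def unital_act_Graft[of G, OF G])
      finally show ?thesis
        by (simp only: Graft product_trees_Graft_left[symmetric] mem_Collect_eq)
    qed
  }
qed

text \<open>
  The product \<open>FG\<close>, extended to series \<open>F\<close> with a term at the trivial tree and regarded as a linear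
  operator on \<open>F\<close>.
\<close>

definition unital_subst :: "'k::field series \<Rightarrow> 'k series \<Rightarrow> 'k series" where
  "unital_subst G F U = (\<Sum>T | size T \<le> size U. F T * unital_act G T U)"

lemma finite_size_le [simp]: "finite {T :: pbt. size T \<le> n}"
proof -
  have "{T :: pbt. size T \<le> n} = (\<Union>m\<le>n. trees m)" by (auto simp: trees_def)
  then show ?thesis by (simp add: finite_trees)
qed

text \<open>
  A common bound for all the coefficients involved lets finite sums be interchanged.
\<close>

lemma unital_subst_bound:
  fixes G :: "'k::field series" and U :: pbt
  assumes "G Triv = 0" "size U \<le> n"
  shows "unital_subst G F U = (\<Sum>T | size T \<le> n. F T * unital_act G T U)"
  unfolding unital_subst_def
  by (rule sum.mono_neutral_left) (use assms in \<open>auto intro!: unital_act_eq_0\<close>)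

text \<open>
  Expanding the right-hand side bilinearly gives a sum over trees \<open>A\<close>, \<open>B\<close> and over the trees \<open>T\<close>
  in their product. Such a triple amounts to a tree \<open>T\<close> with a cut position below its root.
\<close>

lemma unital_subst_usucc:
  fixes G :: "'k::field series"
  assumes G: "G Triv = 0"
  shows "unital_subst G (usucc f g) = usucc (unital_subst G f) (unital_subst G g)"
proof
  fix U :: pbt
  define n where "n = size U"
  let ?B = "{T :: pbt. size T \<le> n}"
  let ?D = "SIGMA (A, B) : ?B \<times> ?B. {T \<in> product_trees A B. size A < rank T}"
  let ?h = "\<lambda>((A, B), T). f A * g B * unital_act G T U"
  have "usucc (unital_subst G f) (unital_subst G g) U =
      (\<Sum>p<rank U. (\<Sum>A\<in>?B. f A * unital_act G A (before p U)) * (\<Sum>B\<in>?B. g B * unital_act G B (after p U)))"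
    unfolding usucc_def
    by (intro sum.cong refl arg_cong2[of _ _ _ _ "(*)"] unital_subst_bound[of G, OF G])
       (use rank_le_size[of U] in \<open>auto simp: n_def\<close>)
  also have "\<dots> = (\<Sum>p<rank U. \<Sum>(A, B)\<in>?B \<times> ?B.
      f A * g B * (unital_act G A (before p U) * unital_act G B (after p U)))"
    by (simp add: sum_product sum.cartesian_product mult_ac)
  also have "\<dots> = (\<Sum>(A, B)\<in>?B \<times> ?B. f A * g B * usucc (unital_act G A) (unital_act G B) U)"
    by (subst sum.swap) (simp add: usucc_def sum_distrib_left case_prod_unfold)
  also have "\<dots> = (\<Sum>(A, B)\<in>?B \<times> ?B. \<Sum>T | T \<in> product_trees A B \<and> size A < rank T. f A * g B * unital_act G T U)"
    by (simp add: unital_act_products[of G, OF G] sum_distrib_left)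
  also have "\<dots> = sum ?h ?D"
    by (subst sum.Sigma[symmetric]) (auto simp: case_prod_unfold)
  \<comment> \<open>\<open>T(G, \<dots>, G)\<close> has no terms smaller than \<open>T\<close>.\<close>
  also have "\<dots> = sum ?h {x \<in> ?D. size (snd x) \<le> n}"
    by (rule sum.mono_neutral_right) (auto simp: n_def not_le intro!: unital_act_eq_0 G)
  also have "\<dots> = (\<Sum>(T, p)\<in>(SIGMA T : ?B. {..<rank T}). f (before p T) * g (after p T) * unital_act G T U)"
  proof (rule sum.reindex_bij_witness[of _ "\<lambda>(T, p). ((before p T, after p T), T)" "\<lambda>((A, B), T). (T, size A)"], goal_cases)
    case (3 b)
    obtain T p where b: "b = (T, p)" "size T \<le> n" "p < rank T" using 3 by auto
    then have "p \<le> size T" using rank_le_size[of T] by simp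
    then show ?case using b by simp
  next
    case (4 b)
    obtain T p where b: "b = (T, p)" "size T \<le> n" "p < rank T" using 4 by auto
    then have "p \<le> size T" using rank_le_size[of T] by simp
    then show ?case using b by (simp add: product_trees_def)
  next
    case (1 a)
    then obtain A B T where "a = ((A, B), T)" "T \<in> product_trees A B" by auto
    then show ?case by (simp add: product_trees_def)
  next
    case (2 a)
    then obtain A B T where "a = ((A, B), T)" "size A < rank T" "size T \<le> n" by auto
    then show ?case by simp
  next
    case (5 a)
    then obtain A B T where "a = ((A, B), T)" "T \<in> product_trees A B" by auto
    then show ?case by (simp add: product_trees_def)
  qed
  also have "\<dots> = unital_subst G (usucc f g) U"
    by (subst sum.Sigma[symmetric]) (auto simp: unital_subst_def usucc_def n_def sum_distrib_right)
  finally show "unital_subst G (usucc f g) U = usucc (unital_subst G f) (unital_subst G g) U" ..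
qed

lemma series_comp_eq_unital_subst:
  assumes "F Triv = 0"
  shows "series_comp F G = unital_subst G F"
proof
  fix U
  show "series_comp F G U = unital_subst G F U"
    unfolding series_comp_def unital_subst_def
    by (rule sum.mono_neutral_cong_left) (use assms in \<open>auto simp: unital_act_def Suc_le_eq neq0_conv[symmetric] simp del: neq0_conv\<close>)
qed

lemma unital_subst_single:
  assumes "G Triv = 0"
  shows "unital_subst G (single T) = unital_act G T"
proof
  fix U
  have "unital_subst G (single T) U = (\<Sum>S | size S \<le> max (size U) (size T). single T S * unital_act G S U)"
    using assms by (intro unital_subst_bound) auto
  also have "\<dots> = (\<Sum>S\<in>{T}. single T S * unital_act G S U)"
    by (rule sum.mono_neutral_right) (auto simp: single_def)
  finally show "unital_subst G (single T) U = unital_act G T U" by simp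
qed

lemma unital_subst_diff: "unital_subst G (f - g) = unital_subst G f - unital_subst G g"
  by (auto simp: unital_subst_def fun_eq_iff left_diff_distrib sum_subtractf)

section \<open>The quadratic equation of an inverse\<close>

lemma unital_act_Y: "G Triv = 0 \<Longrightarrow> unital_act G Y = G"
  by (simp add: unital_act_Graft usucc_unit_left uprec_unit_right)

lemma unital_act_YY: "G Triv = 0 \<Longrightarrow> unital_act G (over Y Y) = usucc G G"
  by (simp add: unital_act_Graft usucc_unit_left uprec_unit_right)

lemma series_comp_Y_minus_YY:
  fixes G :: "'k::field series"
  assumes "G Triv = 0"
  shows "series_comp (single Y - single (over Y Y)) G = G - usucc G G"
proof -
  have "(single Y - single (over Y Y)) Triv = (0 :: 'k)"
    by (simp add: single_def)
  then have "series_comp (single Y - single (over Y Y)) G =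
      unital_subst G (single Y) - unital_subst G (single (over Y Y))"
    by (simp only: series_comp_eq_unital_subst unital_subst_diff)
  then show ?thesis
    by (simp only: unital_subst_single[of G, OF assms] unital_act_Y[of G, OF assms] unital_act_YY[of G, OF assms])
qed

text \<open>
  The coefficient of \<open>K \<succ> K\<close> at \<open>U\<close> only involves coefficients of \<open>K\<close> at trees smaller than \<open>U\<close>:
  the cut at 0 contributes nothing, and all other cuts left of the root have two nontrivial pieces.
\<close>

lemma quadratic_unique:
  fixes K K' :: "'k::field series"
  assumes eq: "K - usucc K K = K' - usucc K' K'" and 0: "K Triv = 0" "K' Triv = 0"
  shows "K = K'"
proof
  fix U
  show "K U = K' U"
  proof (induction "size U" arbitrary: U rule: less_induct)
    case less
    have "usucc K K U = usucc K' K' U"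
      unfolding usucc_def
    proof (intro sum.cong refl)
      fix p assume "p \<in> {..<rank U}"
      then have p: "p < size U" "p < rank U" using rank_le_size[of U] by auto
      show "K (before p U) * K (after p U) = K' (before p U) * K' (after p U)"
      proof (cases "p = 0")
        case False
        then show ?thesis using p less[of "before p U"] less[of "after p U"] by simp
      qed (simp add: 0)
    qed
    then show ?case
      using fun_cong[OF eq, of U] by simp
  qed
qed

section \<open>Counting the elements below a tree\<close>

text \<open>
  The series \<open>| + \<Phi>\<close> (see \<open>lower_eq\<close>).
\<close>

definition lower :: "'k::field series" where
  "lower U = of_nat (card {S. S \<preceq> U})"

lemma finite_lower_set [simp]: "finite {S. S \<preceq> U}"
  by (rule finite_subset[OF _ finite_trees[of "size U"]]) (auto simp: trees_def size_tamari)

lemma lower_Triv [simp]: "lower Triv = 1"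
proof -
  have "{S. S \<preceq> Triv} = {Triv}" using size_tamari by fastforce
  then show ?thesis by (simp add: lower_def)
qed

lemma lower_eq: "lower = (single Triv + Phi :: 'a::field series)"
proof
  fix U
  show "lower U = (single Triv + Phi :: 'a series) U"
  proof (cases "U = Triv")
    case True
    then show ?thesis by (simp add: Phi_def)
  next
    case False
    have fin: "finite (tamari_intervals (size U))"
      by (rule finite_subset[of _ "trees (size U) \<times> trees (size U)"])
         (auto simp: tamari_intervals_def finite_trees)
    have "(\<Sum>(S, T)\<in>tamari_intervals (size U). single T U :: 'a) =
          (\<Sum>(S, T)\<in>(\<lambda>S. (S, U)) ` {S. S \<preceq> U}. single T U)"
      by (rule sum.mono_neutral_right[OF fin])
         (auto simp: tamari_intervals_def trees_def single_def size_tamari)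
    also have "\<dots> = of_nat (card {S. S \<preceq> U})"
      by (subst sum.reindex) (auto simp: inj_on_def)
    finally have "Phi U = (of_nat (card {S. S \<preceq> U}) :: 'a)"
      using False by (simp only: Phi_def if_False)
    then show ?thesis
      using False by (simp add: lower_def single_def)
  qed
qed

lemma usucc_single_Y:
  "usucc f (single Y) U = (case U of Triv \<Rightarrow> 0 | Graft A B \<Rightarrow> if B = Triv then f A else 0)"
proof (cases U)
  case (Graft A B)
  have "usucc f (single Y) U = (\<Sum>p\<in>{size A}. f (before p U) * single Y (after p U))"
    unfolding usucc_def
  proof (rule sum.mono_neutral_right)
    show "\<forall>p\<in>{..<rank U} - {size A}. f (before p U) * single Y (after p U) = 0"
    proof
      fix p assume "p \<in> {..<rank U} - {size A}"
      then have "p \<le> size A" "size (after p A) \<noteq> 0" using Graft by auto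
      then have "p \<le> size A" "after p A \<noteq> Triv" by (simp_all only: size_0_iff simp_thms)
      then show "f (before p U) * single Y (after p U) = 0"
        using Graft by (auto simp: single_def)
    qed
  qed (use Graft in auto)
  then show ?thesis using Graft by (simp add: single_def)
qed simp

text \<open>
  No rotation can involve the root of \<open>A \<or> |\<close>, as this requires a nontrivial right subtree.
\<close>

lemma above_Graft_Triv_step:
  "tamari_step (Graft A Triv) U \<Longrightarrow> \<exists>A'. U = Graft A' Triv \<and> tamari_step A A'"
  by (auto elim: tamari_step.cases)

lemma above_Graft_Triv:
  assumes "Graft A Triv \<preceq> U"
  obtains A' where "U = Graft A' Triv" "A \<preceq> A'"
proof -
  have "\<exists>A'. U = Graft A' Triv \<and> A \<preceq> A'"
    using assms
  proof (induction rule: tamari_induct)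
    case (step U V)
    then show ?case
      by (metis above_Graft_Triv_step tamari_stepI tamari_trans)
  qed auto
  then show thesis using that by blast
qed

text \<open>
  Let \<open>A' \<or> B' \<preceq> U\<close> with \<open>size A' = p\<close>, and cut both trees after the root of \<open>A' \<or> B'\<close>.
  Monotonicity gives \<open>A' \<or> | \<preceq> before (p + 1) U\<close> and \<open>B' \<preceq> B = after (p + 1) U\<close>, so the left piece
  of \<open>U\<close> is some \<open>A \<or> |\<close> with \<open>A' \<preceq> A\<close>. Conversely, such \<open>A'\<close> and \<open>B'\<close> satisfy
  \<open>A' \<or> B' \<preceq> A \<or> B = under (A \<or> |) B \<preceq> U\<close>.
\<close>

lemma lower_set_cut:
  assumes "p < size U"
  shows "of_nat (card {S. S \<preceq> U \<and> rank S = p + 1}) =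
    usucc lower (single Y) (before (p + 1) U) * (lower (after (p + 1) U) :: 'k::field)"
proof (cases "\<exists>A. before (p + 1) U = Graft A Triv")
  case True
  then obtain A where A: "before (p + 1) U = Graft A Triv" by blast
  define B where "B = after (p + 1) U"
  have sA: "size A = p"
    using A assms size_before[of "p + 1" U] by simp
  have "{S. S \<preceq> U \<and> rank S = p + 1} = (\<lambda>(A', B'). Graft A' B') ` ({S. S \<preceq> A} \<times> {S. S \<preceq> B})"
  proof (intro equalityI subsetI)
    fix S assume S: "S \<in> {S. S \<preceq> U \<and> rank S = p + 1}"
    then obtain A' B' where S': "S = Graft A' B'" "size A' = p" by (cases S) auto
    have "before (p + 1) S \<preceq> Graft A Triv" "after (p + 1) S \<preceq> B"
      using S before_mono[of S U "p + 1"] after_mono[of S U "p + 1"] by (simp_all only: A B_def mem_Collect_eq)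
    then have "Graft A' Triv \<preceq> Graft A Triv" "B' \<preceq> B"
      using S' by auto
    then have "A' \<preceq> A" "B' \<preceq> B" by (auto elim: above_Graft_Triv)
    then show "S \<in> (\<lambda>(A', B'). Graft A' B') ` ({S. S \<preceq> A} \<times> {S. S \<preceq> B})"
      using S' by auto
  next
    fix S assume "S \<in> (\<lambda>(A', B'). Graft A' B') ` ({S. S \<preceq> A} \<times> {S. S \<preceq> B})"
    then obtain A' B' where S: "S = Graft A' B'" "A' \<preceq> A" "B' \<preceq> B" by auto
    have "S \<preceq> Graft A B" using S by (simp add: Graft_mono)
    also have "\<dots> \<preceq> U" using under_cut_le[of "p + 1" U] by (simp only: A B_def under.simps)
    finally show "S \<in> {S. S \<preceq> U \<and> rank S = p + 1}"
      using S size_tamari[of A' A] sA by simp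
  qed
  then have "card {S. S \<preceq> U \<and> rank S = p + 1} = card {S. S \<preceq> A} * card {S. S \<preceq> B}"
    by (simp add: card_image inj_on_def card_cartesian_product)
  then show ?thesis
    by (simp only: A usucc_single_Y) (simp add: lower_def B_def)
next
  case False
  have "\<not> S \<preceq> U" if "rank S = p + 1" for S
  proof
    assume "S \<preceq> U"
    then have "before (p + 1) S \<preceq> before (p + 1) U" by (rule before_mono)
    moreover have "\<exists>A. before (p + 1) S = Graft A Triv"
      using that by (cases S) auto
    ultimately show False
      using False by (metis above_Graft_Triv)
  qed
  then have "{S. S \<preceq> U \<and> rank S = p + 1} = {}" by auto
  moreover have "usucc lower (single Y) (before (p + 1) U) = (0 :: 'k)"
    using False by (auto simp: usucc_single_Y split: pbt.split)
  ultimately show ?thesis by (simp only: card.empty of_nat_0 mult_zero_left)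
qed

lemma lower_recursion:
  "lower = (single Triv + ustar (usucc lower (single Y)) lower :: 'a::field series)"
proof
  fix U
  let ?H = "usucc lower (single Y) :: 'a series"
  show "lower U = (single Triv + ustar ?H lower) U"
  proof (cases "U = Triv")
    case True
    then show ?thesis by (simp add: ustar_def)
  next
    case False
    let ?n = "size U"
    have split: "{S. S \<preceq> U} = (\<Union>p<?n. {S. S \<preceq> U \<and> rank S = p + 1})" (is "_ = ?R")
    proof (intro equalityI subsetI)
      fix S assume S: "S \<in> {S. S \<preceq> U}"
      then have "size S = ?n" by (simp add: size_tamari)
      moreover from this have "S \<noteq> Triv" using False by auto
      then obtain A B where "S = Graft A B" by (cases S) auto
      ultimately show "S \<in> ?R" using S by auto
    qed auto
    have "card {S. S \<preceq> U} = (\<Sum>p<?n. card {S. S \<preceq> U \<and> rank S = p + 1})"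
      unfolding split
    proof (rule card_UN_disjoint)
      show "\<forall>i\<in>{..<?n}. finite {S. S \<preceq> U \<and> rank S = i + 1}"
        by (auto intro: finite_subset[OF _ finite_lower_set[of U]])
    qed auto
    then have "lower U = (\<Sum>p<?n. of_nat (card {S. S \<preceq> U \<and> rank S = p + 1}))"
      by (simp add: lower_def)
    also have "\<dots> = (\<Sum>p<?n. ?H (before (p + 1) U) * lower (after (p + 1) U))"
      by (intro sum.cong refl lower_set_cut) auto
    also have "\<dots> = ustar ?H lower U"
      unfolding ustar_def by (simp add: sum.atMost_shift lessThan_Suc_atMost[symmetric] sum.lessThan_Suc_shift del: sum.lessThan_Suc)
    finally show ?thesis using False by (simp add: single_def)
  qed
qed

section \<open>The inverse series\<close>

text \<open>
  Multiply \<open>X = | + H * X\<close> by \<open>\<succ> Y\<close> on the right and use \<open>(H * X) \<succ> Y = H \<succ> (X \<succ> Y)\<close>.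
\<close>

lemma interval_series_quadratic:
  defines "H \<equiv> usucc lower (single Y) :: 'k::field series"
  shows "H - usucc H H = single Y"
proof -
  have add: "usucc (f + g) h = usucc f h + usucc g h" for f g h :: "'k series"
    by (auto simp: usucc_def fun_eq_iff distrib_right sum.distrib)
  have "H = usucc (single Triv + ustar H lower) (single Y)"
    unfolding H_def by (rule arg_cong[OF lower_recursion])
  also have "\<dots> = single Y + usucc H H"
    by (simp only: add star_succ H_def[symmetric]) (simp add: usucc_unit_left single_def[of Y])
  finally show ?thesis by (metis add_diff_cancel_right')
qed

theorem proposition7p2:
  shows "let F = single Y - single (over Y Y) :: 'k::field series;
             H = single Y + partial_comp (over Y Y) 1 Phi
         in F \<in> carrier G_Dend \<and> H \<in> carrier G_Dend \<and>
            F \<otimes>\<^bsub>G_Dend\<^esub> H = \<one>\<^bsub>G_Dend\<^esub> \<and> H \<otimes>\<^bsub>G_Dend\<^esub> F = \<one>\<^bsub>G_Dend\<^esub> \<and>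
            inv\<^bsub>G_Dend\<^esub> F = H"
proof -
  define F :: "'k series" where "F = single Y - single (over Y Y)"
  define H :: "'k series" where "H = single Y + partial_comp (over Y Y) 1 Phi"
  have Y0: "single Y Triv = (0 :: 'k)" by (simp add: single_def)
  have Phi0: "Phi Triv = (0 :: 'k)" by (simp add: Phi_def)
  have H: "H = usucc lower (single Y)"
  proof -
    have "partial_comp (over Y Y) 1 Phi = dsucc Phi (single Y :: 'k series)"
      by (simp add: partial_comp_def)
    also have "\<dots> = usucc Phi (single Y)"
      using Y0 Phi0 by (simp add: dsucc_eq)
    moreover have "usucc lower (single Y) = single Y + usucc Phi (single Y :: 'k series)"
    proof -
      have "usucc (single Triv + Phi) (single Y) = usucc (single Triv) (single Y) + usucc Phi (single Y :: 'k series)"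
        by (auto simp: usucc_def fun_eq_iff distrib_right sum.distrib)
      then show ?thesis using Y0 by (simp add: lower_eq usucc_unit_left)
    qed
    ultimately show ?thesis by (simp add: H_def)
  qed
  have F0: "F Triv = 0" "F Y = 1" and H0: "H Triv = 0" "H Y = 1"
    by (simp_all add: F_def H usucc_single_Y) (simp_all add: single_def)
  have Fmult: "series_comp F G = G - usucc G G" if "G Triv = 0" for G
    using series_comp_Y_minus_YY[of G, OF that] by (simp add: F_def)
  have quadratic: "H - usucc H H = single Y"
    unfolding H by (rule interval_series_quadratic)
  have FH: "series_comp F H = single Y"
    using Fmult[of H, OF H0(1)] quadratic by simp
  define K where "K = series_comp H F"
  have K: "K = unital_subst F H" using H0 by (simp add: K_def series_comp_eq_unital_subst)
  have "K - usucc K K = unital_subst F (H - usucc H H)"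
    by (simp add: K unital_subst_diff unital_subst_usucc F0)
  also have "\<dots> = F"
    by (simp add: quadratic unital_subst_single unital_act_Y F0)
  also have "\<dots> = single Y - usucc (single Y) (single Y)"
    unfolding F_def fun_eq_iff fun_diff_def usucc_single_Y by (auto simp: single_def split: pbt.split)
  finally have "K = single Y"
    by (rule quadratic_unique) (use Y0 in \<open>simp_all add: K unital_subst_def F0 H0\<close>)
  then have HF: "series_comp H F = single Y" by (simp add: K_def)
  have "inv\<^bsub>G_Dend\<^esub> F = H"
    unfolding m_inv_def
  proof (rule the_equality)
    show "H \<in> carrier G_Dend \<and> F \<otimes>\<^bsub>G_Dend\<^esub> H = \<one>\<^bsub>G_Dend\<^esub> \<and> H \<otimes>\<^bsub>G_Dend\<^esub> F = \<one>\<^bsub>G_Dend\<^esub>"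
      using FH HF H0 by (simp add: G_Dend_def)
  next
    fix G assume "G \<in> carrier G_Dend \<and> F \<otimes>\<^bsub>G_Dend\<^esub> G = \<one>\<^bsub>G_Dend\<^esub> \<and> G \<otimes>\<^bsub>G_Dend\<^esub> F = \<one>\<^bsub>G_Dend\<^esub>"
    then have G0: "G Triv = 0" and FG: "series_comp F G = single Y"
      by (simp_all add: G_Dend_def)
    have "G - usucc G G = H - usucc H H"
      by (simp only: Fmult[of G, OF G0, symmetric] FG quadratic)
    then show "G = H"
      using G0 H0(1) by (rule quadratic_unique)
  qed
  moreover have "F \<in> carrier G_Dend" "H \<in> carrier G_Dend"
    "F \<otimes>\<^bsub>G_Dend\<^esub> H = \<one>\<^bsub>G_Dend\<^esub>" "H \<otimes>\<^bsub>G_Dend\<^esub> F = \<one>\<^bsub>G_Dend\<^esub>"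
    using FH HF F0 H0 by (simp_all add: G_Dend_def)
  ultimately show ?thesis
    unfolding Let_def F_def H_def by blast
qed

end
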